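(* Let $L$ be a finite semidistrim lattice. For every $x\in L$, the pair $(\mathcal{D}_L(x),\mathcal{U}_L(x))$ is a tight orthogonal pair of the Galois graph $G_L$.
   Context: All lattices are finite. For a lattice $L$, $\mathcal{J}_L$ (resp. $\mathcal{M}_L$) is the set of join-irreducible (resp. meet-irreducible) elements; for $j\in\mathcal{J}_L$, $j_*$ is the unique element covered by $j$, and for $m\in\mathcal{M}_L$, $m^*$ is the unique element covering $m$. Let $\mathcal{M}_L(j)=\max\{z\in L: j_*=j\wedge z\}$ and $\mathcal{J}_L(m)=\min\{z\in L: m^*=m\vee z\}$. A pairing on $L$ is a bijection $\kappa:\mathcal{J}_L\to\mathcal{M}_L$ with $\kappa(j)\in\mathcal{M}_L(j)$ for all $j$ and $\kappa^{-1}(m)\in\mathcal{J}_L(m)$ for all $m$; $L$ is uniquely paired if it has exactly one pairing, denoted $\kappa_L$. A prime pair is a pair $(j_0,m_0)$ with $L=[\hat0,m_0]\sqcup[j_0,\hat1]$. A uniquely paired lattice $L$ is compatibly dismantlable if $|L|=1$ or there is a prime pair $(j_0,m_0)$ such that: (i) $[j_0,\hat1]$ is compatibly dismantlable and $\alpha(j)=j_0\vee j$ defines a bijection $\{j\in\mathcal{J}_L: j_0\le\kappa_L(j)\}\to\mathcal{J}_{[j_0,\hat1]}$ with $\kappa_{[j_0,\hat1]}(\alpha(j))=\kappa_L(j)$; (ii) $[\hat0,m_0]$ is compatibly dismantlable and $\beta(m)=m_0\wedge m$ defines a bijection $\{m\in\mathcal{M}_L:\kappa_L^{-1}(m)\le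 m_0\}\to\mathcal{M}_{[\hat0,m_0]}$ with $\kappa_{[\hat0,m_0]}^{-1}(\beta(m))=\kappa_L^{-1}(m)$. The Galois graph $G_L$ is the directed graph on $\mathcal{J}_L$ with an edge $j\to j'$ iff $j\ne j'$ and $j\not\le\kappa_L(j')$. For $x\in L$ let $J_L(x)=\{j\in\mathcal{J}_L:j\le x\}$ and $M_L(x)=\{j\in\mathcal{J}_L:\kappa_L(j)\ge x\}$. For a compatibly dismantlable $L$, for every cover $x\lessdot y$ the set $M_L(x)\cap J_L(y)$ has exactly one element $j_{xy}$; set $\mathcal{D}_L(x)=\{j_{yx}:y\lessdot x\}$ and $\mathcal{U}_L(x)=\{j_{xy}:x\lessdot y\}$. $L$ is semidistrim if it is compatibly dismantlable and $\mathcal{D}_L(x)$, $\mathcal{U}_L(x)$ are independent sets of $G_L$ for all $x$. In a directed graph $G$, an orthogonal pair is a pair $(X,Y)$ of disjoint independent sets with no edge $j\to j'$ having $j\in X$, $j'\in Y$. It is tight if: (1) for every vertex $j\notin X\cup Y$, neither $(X\cup\{j\},Y)$ nor $(X,Y\cup\{j\})$ is an orthogonal pair; (2) for every edge $j\to j'$ with $j\notin X\cup Y$ and $j'\in X$, $((X\setminus\{j'\})\cup\{j\},Y)$ is not an orthogonal pair; (3) for every edge $j'\to j$ with $j\notin X\cup Y$ and $j'\in Y$, $(X,(Y\setminus\{j'\})\cup\{j\})$ is not an orthogonal pair. *)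

theory Defs
  imports "Graph_Theory.Pair_Digraph" "HOL-Library.FuncSet"
begin

text \<open>
  The ambient finite lattice is a type of class finite and lattice.  Since the notion of a
  compatibly dismantlable lattice recurses into intervals, the notions below take the carrier
  \<open>S\<close> of the lattice as an argument; it is meant to be \<open>UNIV\<close> or an interval of the ambient
  lattice, so that the order, \<^const>\<open>inf\<close> and \<^const>\<open>sup\<close> of the lattice \<open>S\<close> are
  the restrictions of the ambient ones.
\<close>

definition covers_in :: "'a::lattice set \<Rightarrow> 'a \<Rightarrow> 'a \<Rightarrow> bool" where
  "covers_in S x y \<longleftrightarrow> x \<in> S \<and> y \<in> S \<and> x < y \<and> \<not> (\<exists>z\<in>S. x < z \<and> z < y)"

text \<open>The second conjunct says that \<open>j\<close> is not the least
  (dually, \<open>m\<close> not the greatest) element of \<open>S\<close>.\<close>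

definition join_irreds :: "'a::lattice set \<Rightarrow> 'a set" where
  "join_irreds S = {j \<in> S. \<not> (\<forall>s\<in>S. j \<le> s) \<and>
     (\<forall>x\<in>S. \<forall>y\<in>S. j = sup x y \<longrightarrow> j = x \<or> j = y)}"

definition meet_irreds :: "'a::lattice set \<Rightarrow> 'a set" where
  "meet_irreds S = {m \<in> S. \<not> (\<forall>s\<in>S. s \<le> m) \<and>
     (\<forall>x\<in>S. \<forall>y\<in>S. m = inf x y \<longrightarrow> m = x \<or> m = y)}"

definition lower_cover :: "'a::lattice set \<Rightarrow> 'a \<Rightarrow> 'a" where
  "lower_cover S j = (THE c. covers_in S c j)"

definition upper_cover :: "'a::lattice set \<Rightarrow> 'a \<Rightarrow> 'a" where
  "upper_cover S m = (THE c. covers_in S m c)"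

text \<open>The definite descriptions above are well-defined at irreducible elements.\<close>

lemma join_irreds_ex1_lower_cover:
  fixes S :: "'a::{finite,lattice} set"
  assumes cl: "\<And>x y. x \<in> S \<Longrightarrow> y \<in> S \<Longrightarrow> sup x y \<in> S \<and> inf x y \<in> S"
    and j: "j \<in> join_irreds S"
  shows "\<exists>!c. covers_in S c j"
proof -
  let ?A = "{y \<in> S. y < j}"
  have jS: "j \<in> S" using j by (simp add: join_irreds_def)
  obtain s where s: "s \<in> S" "\<not> j \<le> s" using j by (auto simp: join_irreds_def)
  have "inf j s \<noteq> j" using s by (metis inf_le2)
  then have "inf j s \<in> ?A" using s jS cl by (simp add: less_le)
  then obtain c where c: "c \<in> ?A" "\<forall>b\<in>?A. c \<le> b \<longrightarrow> c = b"
    using finite_has_maximal[of ?A] by fastforce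
  have "covers_in S c j" using c jS by (auto simp: covers_in_def)
  moreover have "d = c" if d: "covers_in S d j" for d
  proof (rule ccontr)
    assume "d \<noteq> c"
    have dc: "sup d c \<in> S" "sup d c \<le> j" "d \<in> S" "c \<in> S" "d < j" "c < j"
      using d c cl by (auto simp: covers_in_def)
    have "j = sup x y \<longrightarrow> j = x \<or> j = y" if "x \<in> S" "y \<in> S" for x y
      using j that by (simp add: join_irreds_def)
    from this[of d c] have "sup d c \<noteq> j" using dc by auto
    with dc have "sup d c \<in> ?A" by (metis (mono_tags, lifting) mem_Collect_eq order_le_imp_less_or_eq)
    with c have cs: "c = sup d c" by (meson sup_ge2)
    then have "d < c" using \<open>d \<noteq> c\<close> by (metis less_le sup_ge1)
    with d dc show False by (auto simp: covers_in_def)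
  qed
  ultimately show ?thesis by blast
qed

lemma meet_irreds_ex1_upper_cover:
  fixes S :: "'a::{finite,lattice} set"
  assumes cl: "\<And>x y. x \<in> S \<Longrightarrow> y \<in> S \<Longrightarrow> sup x y \<in> S \<and> inf x y \<in> S"
    and m: "m \<in> meet_irreds S"
  shows "\<exists>!c. covers_in S m c"
proof -
  let ?A = "{y \<in> S. m < y}"
  have mS: "m \<in> S" using m by (simp add: meet_irreds_def)
  obtain s where s: "s \<in> S" "\<not> s \<le> m" using m by (auto simp: meet_irreds_def)
  have "sup m s \<noteq> m" using s by (metis sup_ge2)
  then have "sup m s \<in> ?A" using s mS cl by (auto simp: less_le)
  then obtain c where c: "c \<in> ?A" "\<forall>b\<in>?A. b \<le> c \<longrightarrow> c = b"
    using finite_has_minimal[of ?A] by fastforce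
  have "covers_in S m c" using c mS by (auto simp: covers_in_def)
  moreover have "d = c" if d: "covers_in S m d" for d
  proof (rule ccontr)
    assume "d \<noteq> c"
    have dc: "inf d c \<in> S" "m \<le> inf d c" "d \<in> S" "c \<in> S" "m < d" "m < c"
      using d c cl by (auto simp: covers_in_def)
    have "m = inf x y \<longrightarrow> m = x \<or> m = y" if "x \<in> S" "y \<in> S" for x y
      using m that by (simp add: meet_irreds_def)
    from this[of d c] have "inf d c \<noteq> m" using dc by auto
    with dc have "inf d c \<in> ?A" by (metis (mono_tags, lifting) mem_Collect_eq order_le_imp_less_or_eq)
    with c have cs: "c = inf d c" by (meson inf_le2)
    then have "c < d" using \<open>d \<noteq> c\<close> by (metis less_le inf_le1)
    with d dc show False by (auto simp: covers_in_def)
  qed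
  ultimately show ?thesis by blast
qed

text \<open>Here max and min of a set denote its sets of maximal and minimal elements.\<close>

definition max_set :: "'a::lattice set \<Rightarrow> 'a \<Rightarrow> 'a set" where
  "max_set S j = {z \<in> S. lower_cover S j = inf j z \<and>
     \<not> (\<exists>w\<in>S. lower_cover S j = inf j w \<and> z < w)}"

definition min_set :: "'a::lattice set \<Rightarrow> 'a \<Rightarrow> 'a set" where
  "min_set S m = {z \<in> S. upper_cover S m = sup m z \<and>
     \<not> (\<exists>w\<in>S. upper_cover S m = sup m w \<and> w < z)}"

definition pairing :: "'a::lattice set \<Rightarrow> ('a \<Rightarrow> 'a) \<Rightarrow> bool" where
  "pairing S k \<longleftrightarrow> bij_betw k (join_irreds S) (meet_irreds S) \<and>
     (\<forall>j\<in>join_irreds S. k j \<in> max_set S j) \<and>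
     (\<forall>m\<in>meet_irreds S. inv_into (join_irreds S) k m \<in> min_set S m)"

text \<open>A pairing is only a function on the join-irreducible elements; to count pairings, the
  values of its total representative elsewhere are fixed by \<^const>\<open>extensional\<close>.\<close>

definition uniquely_paired :: "'a::lattice set \<Rightarrow> bool" where
  "uniquely_paired S \<longleftrightarrow> (\<exists>!k. k \<in> extensional (join_irreds S) \<and> pairing S k)"

definition kappa :: "'a::lattice set \<Rightarrow> 'a \<Rightarrow> 'a" where
  "kappa S = (THE k. k \<in> extensional (join_irreds S) \<and> pairing S k)"

definition kappa_inv :: "'a::lattice set \<Rightarrow> 'a \<Rightarrow> 'a" where
  "kappa_inv S = inv_into (join_irreds S) (kappa S)"

definition up_part :: "'a::lattice set \<Rightarrow> 'a \<Rightarrow> 'a set" where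
  "up_part S a = {x \<in> S. a \<le> x}"

definition down_part :: "'a::lattice set \<Rightarrow> 'a \<Rightarrow> 'a set" where
  "down_part S a = {x \<in> S. x \<le> a}"

definition prime_pair :: "'a::lattice set \<Rightarrow> 'a \<Rightarrow> 'a \<Rightarrow> bool" where
  "prime_pair S j0 m0 \<longleftrightarrow> j0 \<in> S \<and> m0 \<in> S \<and>
     S = down_part S m0 \<union> up_part S j0 \<and> down_part S m0 \<inter> up_part S j0 = {}"

inductive compatibly_dismantlable :: "'a::lattice set \<Rightarrow> bool" where
  singleton: "uniquely_paired S \<Longrightarrow> card S = 1 \<Longrightarrow> compatibly_dismantlable S"
| dismantle: "uniquely_paired S \<Longrightarrow> prime_pair S j0 m0 \<Longrightarrow>
    compatibly_dismantlable (up_part S j0) \<Longrightarrow>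
    bij_betw (\<lambda>j. sup j0 j) {j \<in> join_irreds S. j0 \<le> kappa S j} (join_irreds (up_part S j0)) \<Longrightarrow>
    (\<forall>j\<in>{j \<in> join_irreds S. j0 \<le> kappa S j}. kappa (up_part S j0) (sup j0 j) = kappa S j) \<Longrightarrow>
    compatibly_dismantlable (down_part S m0) \<Longrightarrow>
    bij_betw (\<lambda>m. inf m0 m) {m \<in> meet_irreds S. kappa_inv S m \<le> m0}
      (meet_irreds (down_part S m0)) \<Longrightarrow>
    (\<forall>m\<in>{m \<in> meet_irreds S. kappa_inv S m \<le> m0}.
       kappa_inv (down_part S m0) (inf m0 m) = kappa_inv S m) \<Longrightarrow>
    compatibly_dismantlable S"

definition galois_graph :: "'a::lattice set \<Rightarrow> 'a pair_pre_digraph" where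
  "galois_graph S = \<lparr> pverts = join_irreds S,
     parcs = {(j, j'). j \<in> join_irreds S \<and> j' \<in> join_irreds S \<and>
                       j \<noteq> j' \<and> \<not> j \<le> kappa S j'} \<rparr>"

definition J_below :: "'a::lattice set \<Rightarrow> 'a \<Rightarrow> 'a set" where
  "J_below S x = {j \<in> join_irreds S. j \<le> x}"

definition M_above :: "'a::lattice set \<Rightarrow> 'a \<Rightarrow> 'a set" where
  "M_above S x = {j \<in> join_irreds S. x \<le> kappa S j}"

text \<open>In a compatibly dismantlable lattice the intersection below is a singleton whenever
  \<open>y\<close> covers \<open>x\<close>; the label carries no meaning otherwise.\<close>

definition cover_label :: "'a::lattice set \<Rightarrow> 'a \<Rightarrow> 'a \<Rightarrow> 'a" where
  "cover_label S x y = (THE j. j \<in> M_above S x \<inter> J_below S y)"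

definition down_labels :: "'a::lattice set \<Rightarrow> 'a \<Rightarrow> 'a set" where
  "down_labels S x = {cover_label S y x | y. covers_in S y x}"

definition up_labels :: "'a::lattice set \<Rightarrow> 'a \<Rightarrow> 'a set" where
  "up_labels S x = {cover_label S x y | y. covers_in S x y}"

definition independent_set :: "'v pair_pre_digraph \<Rightarrow> 'v set \<Rightarrow> bool" where
  "independent_set G X \<longleftrightarrow> X \<subseteq> pverts G \<and> (\<forall>u\<in>X. \<forall>v\<in>X. (u, v) \<notin> parcs G)"

definition semidistrim :: "'a::lattice set \<Rightarrow> bool" where
  "semidistrim S \<longleftrightarrow> compatibly_dismantlable S \<and>
     (\<forall>x\<in>S. independent_set (galois_graph S) (down_labels S x) \<and>
            independent_set (galois_graph S) (up_labels S x))"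

definition orthogonal_pair :: "'v pair_pre_digraph \<Rightarrow> 'v set \<Rightarrow> 'v set \<Rightarrow> bool" where
  "orthogonal_pair G X Y \<longleftrightarrow> X \<inter> Y = {} \<and> independent_set G X \<and> independent_set G Y \<and>
     \<not> (\<exists>j\<in>X. \<exists>j'\<in>Y. (j, j') \<in> parcs G)"

definition tight_orthogonal_pair :: "'v pair_pre_digraph \<Rightarrow> 'v set \<Rightarrow> 'v set \<Rightarrow> bool" where
  "tight_orthogonal_pair G X Y \<longleftrightarrow> orthogonal_pair G X Y \<and>
     (\<forall>j\<in>pverts G. j \<notin> X \<union> Y \<longrightarrow>
        \<not> orthogonal_pair G (X \<union> {j}) Y \<and> \<not> orthogonal_pair G X (Y \<union> {j})) \<and>
     (\<forall>j j'. (j, j') \<in> parcs G \<and> j \<notin> X \<union> Y \<and> j' \<in> X \<longrightarrow>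
        \<not> orthogonal_pair G ((X - {j'}) \<union> {j}) Y) \<and>
     (\<forall>j j'. (j', j) \<in> parcs G \<and> j \<notin> X \<union> Y \<and> j' \<in> Y \<longrightarrow>
        \<not> orthogonal_pair G X ((Y - {j'}) \<union> {j}))"

end

theory Submission
  imports Defs
begin

text \<open>
  Two injectivity properties of a compatibly dismantlable lattice drive the proof: for every \<open>u\<close>
  the map \<open>j \<mapsto> u \<squnion> j\<close> is injective on \<open>M(u)\<close>, and for every \<open>v\<close> the map
  \<open>j \<mapsto> v \<sqinter> \<kappa>(j)\<close> is injective on \<open>J(v)\<close>.  Both follow by induction along the
  dismantling.  They make the labels of covers unique.  If exchanging \<open>j' \<in> D(x)\<close> for
  \<open>j\<close> preserved orthogonality, then for \<open>u = x \<sqinter> \<kappa>(j) \<sqinter> \<kappa>(j')\<close> no lower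
  cover of \<open>x\<close> could lie above \<open>u \<squnion> j\<close> or \<open>u \<squnion> j'\<close>.  Both joins would then be equal
  to \<open>x\<close>, whence \<open>j = j'\<close>.
\<close>

section \<open>Closed carriers, and covers in a finite lattice\<close>

definition sublattice :: "'a::lattice set \<Rightarrow> bool" where
  "sublattice S \<longleftrightarrow> (\<forall>x\<in>S. \<forall>y\<in>S. sup x y \<in> S \<and> inf x y \<in> S)"

text \<open>Lets the closure hypothesis pass to both intervals of a dismantling; without closure,
  irreducible elements of a carrier need not have unique covers.\<close>

lemma sublattice_parts:
  assumes "sublattice S"
  shows "sublattice (up_part S a)" "sublattice (down_part S a)"
  using assms
  by (auto simp: sublattice_def up_part_def down_part_def intro: le_supI1 le_infI1)

lemma ex_lower_cover_above:
  fixes x z :: "'a::{finite,lattice}"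
  assumes "z < x"
  obtains y where "covers_in UNIV y x" "z \<le> y"
proof -
  let ?A = "{y. z \<le> y \<and> y < x}"
  obtain y where y: "y \<in> ?A" "\<And>b. b \<in> ?A \<Longrightarrow> y \<le> b \<Longrightarrow> y = b"
    using finite_has_maximal[of ?A] assms by fastforce
  have False if "y < w" "w < x" for w
    using y(1) y(2)[of w] that order_trans[of z y w] by (simp add: less_le_not_le)
  with y(1) have "covers_in UNIV y x"
    by (auto simp: covers_in_def)
  with y that show ?thesis by blast
qed

lemma ex_upper_cover_below:
  fixes x z :: "'a::{finite,lattice}"
  assumes "x < z"
  obtains y where "covers_in UNIV x y" "y \<le> z"
proof -
  let ?A = "{y. x < y \<and> y \<le> z}"
  obtain y where y: "y \<in> ?A" "\<And>b. b \<in> ?A \<Longrightarrow> b \<le> y \<Longrightarrow> y = b"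
    using finite_has_minimal[of ?A] assms by fastforce
  have False if "x < w" "w < y" for w
    using y(1) y(2)[of w] that order_trans[of w y z] by (simp add: less_le_not_le)
  with y(1) have "covers_in UNIV x y"
    by (auto simp: covers_in_def)
  with y that show ?thesis by blast
qed

section \<open>Order properties of the unique pairing\<close>

lemma pairing_kappa: "uniquely_paired S \<Longrightarrow> pairing S (kappa S)"
  unfolding uniquely_paired_def kappa_def by (drule theI') blast

context
  fixes S :: "'a::{finite,lattice} set"
  assumes sub: "sublattice S" and up: "uniquely_paired S"
begin

lemma bij_betw_kappa: "bij_betw (kappa S) (join_irreds S) (meet_irreds S)"
  using pairing_kappa[OF up] by (simp add: pairing_def)

lemma kappa_inv_kappa: "j \<in> join_irreds S \<Longrightarrow> kappa_inv S (kappa S j) = j"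
  using bij_betw_kappa by (simp add: kappa_inv_def bij_betw_def)

lemma kappa_kappa_inv: "m \<in> meet_irreds S \<Longrightarrow> kappa S (kappa_inv S m) = m"
  using bij_betw_kappa by (simp add: kappa_inv_def bij_betw_def f_inv_into_f)

lemma kappa_in: "j \<in> join_irreds S \<Longrightarrow> kappa S j \<in> meet_irreds S"
  using bij_betw_kappa by (auto simp: bij_betw_def)

lemma kappa_inv_in: "m \<in> meet_irreds S \<Longrightarrow> kappa_inv S m \<in> join_irreds S"
  using bij_betw_kappa by (metis bij_betw_def inv_into_into kappa_inv_def)

lemma covers_inf_kappa:
  assumes "j \<in> join_irreds S"
  shows "covers_in S (inf j (kappa S j)) j"
proof -
  have "\<exists>!c. covers_in S c j"
    using join_irreds_ex1_lower_cover[OF _ assms] sub by (simp add: sublattice_def)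
  then have "covers_in S (lower_cover S j) j"
    unfolding lower_cover_def by (rule theI')
  then show ?thesis
    using pairing_kappa[OF up] assms by (simp add: pairing_def max_set_def)
qed

lemma covers_sup_kappa:
  assumes "j \<in> join_irreds S"
  shows "covers_in S (kappa S j) (sup (kappa S j) j)"
proof -
  note m = kappa_in[OF assms]
  have "\<exists>!c. covers_in S (kappa S j) c"
    using meet_irreds_ex1_upper_cover[OF _ m] sub by (simp add: sublattice_def)
  then have "covers_in S (kappa S j) (upper_cover S (kappa S j))"
    unfolding upper_cover_def by (rule theI')
  moreover have "kappa_inv S (kappa S j) \<in> min_set S (kappa S j)"
    using pairing_kappa[OF up] m by (simp add: pairing_def kappa_inv_def)
  ultimately show ?thesis
    using assms by (simp add: kappa_inv_kappa min_set_def)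
qed

lemma not_le_kappa: "j \<in> join_irreds S \<Longrightarrow> \<not> j \<le> kappa S j"
  using covers_inf_kappa by (force simp: covers_in_def inf_absorb1)

text \<open>The lower cover of \<open>j\<close> is \<open>c = inf j (kappa S j)\<close>. If
  \<open>a\<close> were not below \<open>kappa S j\<close>, then \<open>c < sup c a <= j\<close>, so
  the cover forces \<open>sup c a = j\<close>, against join-irreducibility.\<close>

lemma kappa_ge_if_less:
  assumes j: "j \<in> join_irreds S" and "a \<in> S" "a < j"
  shows "a \<le> kappa S j"
proof (rule ccontr)
  assume "\<not> ?thesis"
  let ?c = "inf j (kappa S j)"
  have c: "covers_in S ?c j" by (rule covers_inf_kappa[OF j])
  then have "sup ?c a \<in> S" "?c < sup ?c a" "sup ?c a \<le> j"
    using sub assms \<open>\<not> a \<le> kappa S j\<close>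
    by (auto simp: sublattice_def covers_in_def less_le_not_le)
  then have "j = sup ?c a"
    using c by (auto simp: covers_in_def order.order_iff_strict)
  moreover have "?c \<in> S" using c by (simp add: covers_in_def)
  ultimately have "j = ?c \<or> j = a"
    using j \<open>a \<in> S\<close> unfolding join_irreds_def by blast
  then show False
    using c \<open>a < j\<close> by (auto simp: covers_in_def)
qed

text \<open>Order dual of \<open>kappa_ge_if_less\<close>, with the upper cover of
  \<open>kappa S j\<close>.\<close>

lemma le_if_kappa_less:
  assumes j: "j \<in> join_irreds S" and "a \<in> S" "kappa S j < a"
  shows "j \<le> a"
proof (rule ccontr)
  assume "\<not> ?thesis"
  let ?c = "sup (kappa S j) j"
  have c: "covers_in S (kappa S j) ?c" by (rule covers_sup_kappa[OF j])
  then have "inf ?c a \<in> S" "inf ?c a < ?c" "kappa S j \<le> inf ?c a"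
    using sub assms \<open>\<not> j \<le> a\<close>
    by (auto simp: sublattice_def covers_in_def less_le_not_le)
  then have "kappa S j = inf ?c a"
    using c by (auto simp: covers_in_def order.order_iff_strict)
  moreover have "?c \<in> S" using c by (simp add: covers_in_def)
  ultimately have "kappa S j = ?c \<or> kappa S j = a"
    using kappa_in[OF j] \<open>a \<in> S\<close> unfolding meet_irreds_def by blast
  then show False
    using c \<open>kappa S j < a\<close> by (auto simp: covers_in_def)
qed

text \<open>If two elements not above \<open>j0\<close> had join \<open>j0\<close>, both would lie
  below \<open>m0\<close>, and so would \<open>j0\<close>, against disjointness. Since
  \<open>kappa S j0\<close> is not above \<open>j0\<close>, it lies below \<open>m0\<close>; both
  meet \<open>j0\<close> in its lower cover, so maximality of \<open>kappa S j0\<close> gives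
  equality.\<close>

lemma prime_pair_kappa:
  assumes pp: "prime_pair S j0 m0"
  shows "j0 \<in> join_irreds S" "kappa S j0 = m0"
proof -
  have S: "j0 \<in> S" "m0 \<in> S" and cases: "\<And>x. x \<in> S \<Longrightarrow> x \<le> m0 \<or> j0 \<le> x"
    and disj: "\<And>x. x \<in> S \<Longrightarrow> x \<le> m0 \<Longrightarrow> j0 \<le> x \<Longrightarrow> False"
    using pp unfolding prime_pair_def up_part_def down_part_def by blast+
  show J: "j0 \<in> join_irreds S"
    unfolding join_irreds_def using S cases disj
    by (smt (verit) mem_Collect_eq order_refl le_sup_iff order_antisym sup_ge1 sup_ge2)
  have k: "kappa S j0 \<in> max_set S j0"
    using pairing_kappa[OF up] J by (simp add: pairing_def)
  then have kS: "kappa S j0 \<in> S" and lc: "lower_cover S j0 = inf j0 (kappa S j0)"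
    by (auto simp: max_set_def)
  have le: "kappa S j0 \<le> m0"
    using cases[OF kS] not_le_kappa[OF J] by blast
  have "inf j0 m0 < j0"
    using S disj[of j0] by (metis inf.absorb_iff1 inf_le1 order.not_eq_order_implies_strict order_refl)
  moreover have "inf j0 m0 \<in> S"
    using S sub by (simp add: sublattice_def)
  moreover have "inf j0 (kappa S j0) \<le> inf j0 m0"
    using le by (simp add: le_infI2)
  ultimately have "inf j0 (kappa S j0) = inf j0 m0"
    using covers_inf_kappa[OF J] by (auto simp: covers_in_def order.order_iff_strict)
  then show "kappa S j0 = m0"
    using k lc le S by (auto simp: max_set_def order.order_iff_strict)
qed

end

section \<open>Existence and injectivity of labels, by induction along the dismantling\<close>

lemma compatibly_dismantlable_uniquely_paired:
  "compatibly_dismantlable S \<Longrightarrow> uniquely_paired S"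
  by (induction rule: compatibly_dismantlable.induct)

text \<open>The three claims share one induction because they use the same translation of
  irreducibles and pairings between \<open>S\<close> and its two intervals; each needs only its own
  induction hypothesis.\<close>

lemma compatibly_dismantlable_labels:
  fixes S :: "'a::{finite,lattice} set"
  assumes "compatibly_dismantlable S" "sublattice S"
  shows "\<And>x y. x \<in> S \<Longrightarrow> y \<in> S \<Longrightarrow> x < y \<Longrightarrow> M_above S x \<inter> J_below S y \<noteq> {}"
    and "\<And>u. u \<in> S \<Longrightarrow> inj_on (\<lambda>j. sup u j) (M_above S u)"
    and "\<And>v. v \<in> S \<Longrightarrow> inj_on (\<lambda>j. inf v (kappa S j)) (J_below S v)"
proof -
  have "(\<forall>x\<in>S. \<forall>y\<in>S. x < y \<longrightarrow> M_above S x \<inter> J_below S y \<noteq> {}) \<and>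
    (\<forall>u\<in>S. inj_on (\<lambda>j. sup u j) (M_above S u)) \<and>
    (\<forall>v\<in>S. inj_on (\<lambda>j. inf v (kappa S j)) (J_below S v))"
    using assms
  proof (induction rule: compatibly_dismantlable.induct)
    case (singleton S)
    then obtain s where "S = {s}" by (auto simp: card_1_singleton_iff)
    then have "join_irreds S = {}" by (auto simp: join_irreds_def)
    with \<open>S = {s}\<close> show ?case by (simp add: M_above_def J_below_def)
  next
    case (dismantle S j0 m0)
    note sub = \<open>sublattice S\<close> and unq = \<open>uniquely_paired S\<close>
    let ?U = "up_part S j0" and ?D = "down_part S m0" and ?k = "kappa S"
    have subU: "sublattice ?U" and subD: "sublattice ?D"
      using sub by (rule sublattice_parts)+
    have unqD: "uniquely_paired ?D"
      using dismantle.hyps by (simp add: compatibly_dismantlable_uniquely_paired)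
    have j0S: "j0 \<in> S" and m0S: "m0 \<in> S"
      and cases: "\<And>x. x \<in> S \<Longrightarrow> x \<in> ?D \<or> x \<in> ?U"
      and disj: "\<And>x. x \<in> S \<Longrightarrow> x \<le> m0 \<Longrightarrow> j0 \<le> x \<Longrightarrow> False"
      using \<open>prime_pair S j0 m0\<close> unfolding prime_pair_def up_part_def down_part_def by blast+
    note j0 = prime_pair_kappa[OF sub unq \<open>prime_pair S j0 m0\<close>]
    have JS: "j \<in> S" if "j \<in> join_irreds S" for j
      using that by (simp add: join_irreds_def)
    have kS: "?k j \<in> S" if "j \<in> join_irreds S" for j
      using kappa_in[OF sub unq that] by (simp add: meet_irreds_def)
    \<comment> \<open>So every join-irreducible above \<open>j0\<close>, except \<open>j0\<close>
      itself, lies in the domain of the bijection onto the join-irreducibles of the upper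
      interval.\<close>
    have ge_j0: "j = j0 \<or> j0 \<le> ?k j" if "j \<in> join_irreds S" "j0 \<le> j" for j
      using kappa_ge_if_less[OF sub unq that(1) j0S] that(2) by (auto simp: order.order_iff_strict)
    \<comment> \<open>If \<open>kappa S j = m0 = kappa S j0\<close>, injectivity of the pairing
      gives \<open>j = j0\<close>; otherwise \<open>m0\<close> lies strictly above
      \<open>kappa S j\<close>, hence above \<open>j\<close>.\<close>
    have le_m0: "j = j0 \<or> j \<le> m0" if "j \<in> join_irreds S" "?k j \<le> m0" for j
      using le_if_kappa_less[OF sub unq that(1) m0S] that j0 kappa_inv_kappa[OF sub unq]
      by (metis order.order_iff_strict)
    note [simp] = M_above_def J_below_def
    have U: "sup j0 j \<in> join_irreds ?U" "kappa ?U (sup j0 j) = ?k j"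
      if "j \<in> join_irreds S" "j0 \<le> ?k j" for j
      using dismantle.hyps(4,5) that by (auto simp: bij_betw_def)
    note U_kappa = U(2)
    have U_inj: "i = j" if "i \<in> join_irreds S" "j0 \<le> ?k i" "j \<in> join_irreds S" "j0 \<le> ?k j"
      "sup j0 i = sup j0 j" for i j
      using dismantle.hyps(4) that by (auto simp: bij_betw_def inj_on_def)
    have U_surj: "\<exists>j\<in>join_irreds S. j0 \<le> ?k j \<and> i = sup j0 j" if "i \<in> join_irreds ?U" for i
      using dismantle.hyps(4) that by (auto simp: bij_betw_def)
    \<comment> \<open>Condition (ii) speaks of meet-irreducibles. Read at
      \<open>m = kappa S j\<close>, it says that join-irreducibles below \<open>m0\<close> stay
      join-irreducible in the lower interval, and only their partners get cut down by
      \<open>m0\<close>.\<close>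
    have D: "j \<in> join_irreds ?D" "kappa ?D j = inf m0 (?k j)"
      if "j \<in> join_irreds S" "j \<le> m0" for j
    proof -
      have m: "?k j \<in> meet_irreds S" "kappa_inv S (?k j) = j"
        using kappa_in[OF sub unq] kappa_inv_kappa[OF sub unq] that by auto
      then have "inf m0 (?k j) \<in> meet_irreds ?D" "kappa_inv ?D (inf m0 (?k j)) = j"
        using dismantle.hyps(7,8) that by (auto simp: bij_betw_def)
      then show "j \<in> join_irreds ?D" "kappa ?D j = inf m0 (?k j)"
        using kappa_inv_in[OF subD unqD] kappa_kappa_inv[OF subD unqD] by metis+
    qed
    note D_kappa = D(2)
    have D_inj: "i = j" if "i \<in> join_irreds S" "i \<le> m0" "j \<in> join_irreds S" "j \<le> m0"
      "inf m0 (?k i) = inf m0 (?k j)" for i j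
      using D that kappa_inv_kappa[OF subD unqD] by metis
    have D_surj: "i \<in> join_irreds S \<and> i \<le> m0" if i: "i \<in> join_irreds ?D" for i
    proof -
      have "kappa ?D i \<in> meet_irreds ?D" by (rule kappa_in[OF subD unqD i])
      then obtain m where m: "m \<in> meet_irreds S" "kappa_inv S m \<le> m0" "kappa ?D i = inf m0 m"
        using dismantle.hyps(7) by (auto simp: bij_betw_def)
      then have "i = kappa_inv S m"
        using dismantle.hyps(8) kappa_inv_kappa[OF subD unqD i] by auto
      with m kappa_inv_in[OF sub unq] show ?thesis by auto
    qed
    have IHU: "\<exists>j\<in>join_irreds ?U. x \<le> kappa ?U j \<and> j \<le> y"
      if "x \<in> ?U" "y \<in> ?U" "x < y" for x y
      using dismantle.IH(1)[OF subU] that by fastforce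
    have IHU_sup: "i = j" if "u \<in> ?U" "i \<in> join_irreds ?U" "j \<in> join_irreds ?U"
      "u \<le> kappa ?U i" "u \<le> kappa ?U j" "sup u i = sup u j" for u i j
      using dismantle.IH(1)[OF subU] that by (auto simp: inj_on_def)
    have IHU_inf: "i = j" if "v \<in> ?U" "i \<in> join_irreds ?U" "j \<in> join_irreds ?U"
      "i \<le> v" "j \<le> v" "inf v (kappa ?U i) = inf v (kappa ?U j)" for v i j
      using dismantle.IH(1)[OF subU] that by (auto simp: inj_on_def)
    have IHD: "\<exists>j\<in>join_irreds ?D. x \<le> kappa ?D j \<and> j \<le> y"
      if "x \<in> ?D" "y \<in> ?D" "x < y" for x y
      using dismantle.IH(2)[OF subD] that by fastforce
    have IHD_sup: "i = j" if "u \<in> ?D" "i \<in> join_irreds ?D" "j \<in> join_irreds ?D"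
      "u \<le> kappa ?D i" "u \<le> kappa ?D j" "sup u i = sup u j" for u i j
      using dismantle.IH(2)[OF subD] that by (auto simp: inj_on_def)
    have IHD_inf: "i = j" if "v \<in> ?D" "i \<in> join_irreds ?D" "j \<in> join_irreds ?D"
      "i \<le> v" "j \<le> v" "inf v (kappa ?D i) = inf v (kappa ?D j)" for v i j
      using dismantle.IH(2)[OF subD] that by (auto simp: inj_on_def)
    have "\<exists>j\<in>join_irreds S. x \<le> ?k j \<and> j \<le> y" if S: "x \<in> S" "y \<in> S" and "x < y" for x y
    proof -
      consider (U) "x \<in> ?U" "y \<in> ?U" | (D) "x \<in> ?D" "y \<in> ?D" | (DU) "x \<in> ?D" "y \<in> ?U"
        using cases[OF S(1)] cases[OF S(2)] \<open>x < y\<close>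
        by (fastforce simp: up_part_def down_part_def)
      then show ?thesis
      proof cases
        case U
        then show ?thesis
          using IHU[OF U \<open>x < y\<close>] U_surj U_kappa
          by (metis le_sup_iff)
      next
        case D
        then show ?thesis
          using IHD[OF D \<open>x < y\<close>] D_surj D_kappa
          by (metis le_inf_iff)
      next
        \<comment> \<open>Here \<open>j0\<close> itself is the witness, because its partner is
          \<open>m0\<close>.\<close>
        case DU
        then show ?thesis
          using j0 by (auto simp: up_part_def down_part_def)
      qed
    qed
    moreover have "i = j"
      if "u \<in> S" "i \<in> join_irreds S" "j \<in> join_irreds S" "u \<le> ?k i" "u \<le> ?k j"
        "sup u i = sup u j" for u i j
    proof -
      \<comment> \<open>When \<open>j0 <= u\<close>, joining \<open>i\<close> with \<open>j0\<close>
        does not change \<open>sup u i\<close>, so the claim descends to the upper interval. The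
        element \<open>u\<close> is generalised because the last case applies this to
        \<open>sup u j0\<close>.\<close>
      have upper: "i = j" if "u \<in> ?U" "i \<in> join_irreds S" "j \<in> join_irreds S" "u \<le> ?k i" "u \<le> ?k j"
        "sup u i = sup u j" for u i j
      proof -
        have "j0 \<le> u" using \<open>u \<in> ?U\<close> by (simp add: up_part_def)
        then have "j0 \<le> ?k i" "j0 \<le> ?k j" and s: "sup u (sup j0 l) = sup u l" for l
          using that by (auto simp: sup_absorb1 simp flip: sup_assoc)
        then show ?thesis
          using IHU_sup[OF \<open>u \<in> ?U\<close>, of "sup j0 i" "sup j0 j"] U U_inj that by simp
      qed
      have mixed: False if "u \<le> m0" "l \<in> S" "l \<le> m0" "j0 \<le> l'" "sup u l = sup u l'" for l l'
        using that disj[of "sup u l"] \<open>u \<in> S\<close> sub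
        by (metis le_sup_iff sublattice_def sup.coboundedI2)
      \<comment> \<open>If \<open>l\<close> were not \<open>j0\<close>, then
        \<open>j0 <= kappa S l\<close>, so \<open>sup u l = sup u j0\<close> would lie below
        \<open>kappa S l\<close>, and with it \<open>l\<close>.\<close>
      have bottom: "l = j0" if "l \<in> join_irreds S" "j0 \<le> l" "u \<le> ?k l" "sup u j0 = sup u l" for l
        using that ge_j0[of l] not_le_kappa[OF sub unq, of l] by (metis le_sup_iff order_trans sup_least)
      note prems = that
      consider "u \<in> ?U" | "u \<le> m0" "i \<le> m0" "j \<le> m0" | "u \<le> m0" "j0 \<le> i" "j0 \<le> j"
        using cases[of u] cases[of i] cases[of j] mixed[of i j] mixed[of j i] prems
          JS[of i] JS[of j]
        by (auto simp: up_part_def down_part_def)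
      then show ?thesis
      proof cases
        case 1
        then show ?thesis using upper that by blast
      next
        case 2
        then show ?thesis
          using IHD_sup[of u i j] D that by (simp add: down_part_def)
      next
        \<comment> \<open>Unless \<open>i\<close> or \<open>j\<close> is \<open>j0\<close>, both
          partners lie above \<open>j0\<close>, so \<open>u\<close> can be raised to
          \<open>sup u j0\<close> in the upper interval; the joins with \<open>i\<close> and
          \<open>j\<close> do not change.\<close>
        case 3
        show ?thesis
        proof (cases "i = j0 \<or> j = j0")
          case True
          then show ?thesis using bottom[of i] bottom[of j] 3 that by metis
        next
          case False
          then have "j0 \<le> ?k i" "j0 \<le> ?k j" using ge_j0 3 that by auto
          moreover have "sup u j0 \<in> ?U"
            using sub \<open>u \<in> S\<close> j0S by (simp add: up_part_def sublattice_def)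
          moreover have "sup (sup u j0) i = sup (sup u j0) j"
            using 3 that by (simp add: sup_assoc sup_absorb2)
          ultimately show ?thesis using upper[of "sup u j0" i j] that by simp
        qed
      qed
    qed
    moreover have "i = j"
      if "v \<in> S" "i \<in> join_irreds S" "j \<in> join_irreds S" "i \<le> v" "j \<le> v"
        "inf v (?k i) = inf v (?k j)" for v i j
    proof -
      have lower: "i = j" if "v \<in> ?D" "i \<in> join_irreds S" "j \<in> join_irreds S" "i \<le> v" "j \<le> v"
        "inf v (?k i) = inf v (?k j)" for v i j
      proof -
        have "v \<le> m0" using \<open>v \<in> ?D\<close> by (simp add: down_part_def)
        then have "i \<le> m0" "j \<le> m0" and s: "inf v (inf m0 l) = inf v l" for l
          using that by (auto simp: inf_absorb1 simp flip: inf_assoc)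
        then show ?thesis
          using IHD_inf[OF \<open>v \<in> ?D\<close>, of i j] D that by simp
      qed
      have mixed: False if "j0 \<le> v" "l \<in> S" "j0 \<le> l" "l' \<le> m0" "inf v l = inf v l'" for l l'
        using that disj[of "inf v l"] \<open>v \<in> S\<close> sub
        by (metis le_inf_iff sublattice_def inf.coboundedI2)
      have top: "l = j0" if "l \<in> join_irreds S" "?k l \<le> m0" "l \<le> v" "inf v m0 = inf v (?k l)" for l
        using that le_m0[of l] not_le_kappa[OF sub unq, of l] by (metis le_inf_iff)
      note prems = that
      \<comment> \<open>Dual to the previous claim, but split by the positions of the partners
        \<open>kappa S i\<close> and \<open>kappa S j\<close> instead of \<open>i\<close> and
        \<open>j\<close>. In the third case \<open>v\<close> is lowered to
        \<open>inf v m0\<close>.\<close>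
      consider "v \<in> ?D" | "j0 \<le> v" "j0 \<le> ?k i" "j0 \<le> ?k j" | "j0 \<le> v" "?k i \<le> m0" "?k j \<le> m0"
        using cases[of v] cases[of "?k i"] cases[of "?k j"] prems kS[of i] kS[of j]
          mixed[of "?k i" "?k j"] mixed[of "?k j" "?k i"]
        by (auto simp: up_part_def down_part_def)
      then show ?thesis
      proof cases
        case 1
        then show ?thesis using lower that by blast
      next
        case 2
        then show ?thesis
          using IHU_inf[of v "sup j0 i" "sup j0 j"] U U_inj that by (simp add: up_part_def)
      next
        case 3
        show ?thesis
        proof (cases "i = j0 \<or> j = j0")
          case True
          then show ?thesis using top[of i] top[of j] 3 that j0 by metis
        next
          case False
          then have "i \<le> m0" "j \<le> m0" using le_m0 3 that by auto
          moreover have "inf v m0 \<in> ?D"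
            using sub \<open>v \<in> S\<close> m0S by (simp add: down_part_def sublattice_def)
          moreover have "inf (inf v m0) (?k i) = inf (inf v m0) (?k j)"
            using 3 that by (simp add: inf_assoc inf_absorb2)
          ultimately show ?thesis using lower[of "inf v m0" i j] that by simp
        qed
      qed
    qed
    ultimately show ?case by (fastforce simp: inj_on_def)
  qed
  then show "\<And>x y. x \<in> S \<Longrightarrow> y \<in> S \<Longrightarrow> x < y \<Longrightarrow> M_above S x \<inter> J_below S y \<noteq> {}"
    and "\<And>u. u \<in> S \<Longrightarrow> inj_on (\<lambda>j. sup u j) (M_above S u)"
    and "\<And>v. v \<in> S \<Longrightarrow> inj_on (\<lambda>j. inf v (kappa S j)) (J_below S v)"
    by blast+
qed

section \<open>Labels of covers in a compatibly dismantlable lattice\<close>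

context
  assumes cd: "compatibly_dismantlable (UNIV :: 'a::{finite,lattice} set)"
begin

abbreviation (input) \<kappa> :: "'a \<Rightarrow> 'a" where "\<kappa> \<equiv> kappa UNIV"
abbreviation (input) JI :: "'a set" where "JI \<equiv> join_irreds UNIV"

lemma sublattice_UNIV: "sublattice (UNIV :: 'a set)"
  by (simp add: sublattice_def)

lemmas labels = compatibly_dismantlable_labels[OF cd sublattice_UNIV, simplified]
lemmas not_le_kappa_UNIV =
  not_le_kappa[OF sublattice_UNIV compatibly_dismantlable_uniquely_paired[OF cd]]

lemma sup_inj:
  assumes "i \<in> JI" "j \<in> JI" "u \<le> \<kappa> i" "u \<le> \<kappa> j" "sup u i = sup u j"
  shows "i = j"
  using labels(2)[of u] assms by (auto simp: inj_on_def M_above_def)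

lemma inf_inj:
  assumes "i \<in> JI" "j \<in> JI" "i \<le> v" "j \<le> v" "inf v (\<kappa> i) = inf v (\<kappa> j)"
  shows "i = j"
  using labels(3)[of v] assms by (auto simp: inj_on_def J_below_def)

text \<open>A candidate \<open>j\<close> is not below \<open>x\<close>, since \<open>x\<close> lies
  below its partner; as \<open>y\<close> covers \<open>x\<close>, this forces
  \<open>sup x j = y\<close>. Injectivity of the join with \<open>x\<close> then leaves only one
  candidate, so the definite description is justified.\<close>

lemma cover_label_eq_iff:
  assumes c: "covers_in UNIV x y"
  shows "cover_label UNIV x y = j \<longleftrightarrow> j \<in> JI \<and> x \<le> \<kappa> j \<and> j \<le> y"
proof -
  have "x < y" using c by (simp add: covers_in_def)
  then have ex: "\<exists>j. j \<in> M_above UNIV x \<inter> J_below UNIV y"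
    using labels(1) by blast
  have eq: "sup x j = y" if "j \<in> M_above UNIV x \<inter> J_below UNIV y" for j
  proof -
    have "\<not> j \<le> x"
      using that not_le_kappa_UNIV[of j] by (auto simp: M_above_def)
    then have "x < sup x j" by (simp add: less_le_not_le)
    moreover have "sup x j \<le> y"
      using that \<open>x < y\<close> by (simp add: J_below_def)
    ultimately show ?thesis
      using c by (auto simp: covers_in_def order.order_iff_strict)
  qed
  have ex1: "\<exists>!j. j \<in> M_above UNIV x \<inter> J_below UNIV y"
    using ex eq labels(2)[of x] by (metis IntD1 inj_onD)
  have "cover_label UNIV x y = j \<longleftrightarrow> j \<in> M_above UNIV x \<inter> J_below UNIV y"
    unfolding cover_label_def using the1_equality[OF ex1] theI'[OF ex1] by blast
  then show ?thesis by (simp add: M_above_def J_below_def conj_ac)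
qed

lemma down_labels_eq:
  "down_labels UNIV x = {j \<in> JI. j \<le> x \<and> (\<exists>y. covers_in UNIV y x \<and> y \<le> \<kappa> j)}"
proof -
  have "down_labels UNIV x = {j. \<exists>y. covers_in UNIV y x \<and> cover_label UNIV y x = j}"
    unfolding down_labels_def by blast
  then show ?thesis
    by (auto simp: cover_label_eq_iff cong: conj_cong)
qed

lemma up_labels_eq:
  "up_labels UNIV x = {j \<in> JI. x \<le> \<kappa> j \<and> (\<exists>y. covers_in UNIV x y \<and> j \<le> y)}"
proof -
  have "up_labels UNIV x = {j. \<exists>y. covers_in UNIV x y \<and> cover_label UNIV x y = j}"
    unfolding up_labels_def by blast
  then show ?thesis
    by (auto simp: cover_label_eq_iff cong: conj_cong)
qed

text \<open>Some lower cover of \<open>x\<close> lies above \<open>z\<close>, and the partner of its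
  label lies above that cover.\<close>

lemma below_label:
  fixes x z :: 'a
  assumes "z < x"
  obtains d where "d \<in> down_labels UNIV x" "z \<le> \<kappa> d"
proof -
  obtain y where y: "covers_in UNIV y x" "z \<le> y"
    using assms by (rule ex_lower_cover_above)
  then have "z \<le> \<kappa> (cover_label UNIV y x)"
    using cover_label_eq_iff[OF y(1), of "cover_label UNIV y x"] by auto
  with y that show thesis by (auto simp: down_labels_def)
qed

lemma above_label:
  fixes x z :: 'a
  assumes "x < z"
  obtains d where "d \<in> up_labels UNIV x" "d \<le> z"
proof -
  obtain y where y: "covers_in UNIV x y" "y \<le> z"
    using assms by (rule ex_upper_cover_below)
  then have "cover_label UNIV x y \<le> z"
    using cover_label_eq_iff[OF y(1), of "cover_label UNIV x y"] by auto
  with y that show thesis by (auto simp: up_labels_def)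
qed

text \<open>In effect \<open>x\<close> is the join of its down labels. Otherwise
  \<open>inf x z < x\<close> lies below the partner of a down label \<open>d\<close>; but
  \<open>d\<close> is below both \<open>x\<close> and \<open>z\<close>, hence below its own
  partner.\<close>

lemma le_if_down_labels_le:
  fixes x z :: 'a
  assumes "\<And>d. d \<in> down_labels UNIV x \<Longrightarrow> d \<le> z"
  shows "x \<le> z"
proof (rule ccontr)
  assume "\<not> x \<le> z"
  then have "inf x z < x" by (simp add: less_le_not_le)
  then obtain d where "d \<in> down_labels UNIV x" "inf x z \<le> \<kappa> d" by (rule below_label)
  moreover from this have "d \<le> inf x z" "d \<in> JI" using assms by (auto simp: down_labels_eq)
  ultimately show False using not_le_kappa_UNIV by (meson order_trans)
qed

text \<open>Dually, \<open>x\<close> is the meet of the partners of its up labels.\<close>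

lemma ge_if_up_labels_ge:
  fixes x z :: 'a
  assumes "\<And>d. d \<in> up_labels UNIV x \<Longrightarrow> z \<le> \<kappa> d"
  shows "z \<le> x"
proof (rule ccontr)
  assume "\<not> z \<le> x"
  then have "x < sup x z" by (simp add: less_le_not_le)
  then obtain d where "d \<in> up_labels UNIV x" "d \<le> sup x z" by (rule above_label)
  moreover from this have "sup x z \<le> \<kappa> d" "d \<in> JI" using assms by (auto simp: up_labels_eq)
  ultimately show False using not_le_kappa_UNIV by (meson order_trans)
qed

section \<open>Exchanging one label\<close>

lemma down_label_exchange:
  assumes j: "j \<in> JI" "j \<le> x" and j': "j' \<in> down_labels UNIV x"
    and edge: "\<not> j \<le> \<kappa> j'"
    and dk: "\<And>d. d \<in> down_labels UNIV x \<Longrightarrow> d \<noteq> j' \<Longrightarrow> d \<le> \<kappa> j \<and> d \<le> \<kappa> j'"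
  shows "j = j'"
proof -
  let ?u = "inf x (inf (\<kappa> j) (\<kappa> j'))"
  have j'J: "j' \<in> JI" "j' \<le> x" using j' by (auto simp: down_labels_eq)
  have du: "d \<le> ?u" "\<not> ?u \<le> \<kappa> d" if "d \<in> down_labels UNIV x" "d \<noteq> j'" for d
  proof -
    have d: "d \<in> JI" "d \<le> x" using that by (auto simp: down_labels_eq)
    with dk[OF that] show le: "d \<le> ?u" by simp
    show "\<not> ?u \<le> \<kappa> d"
      using order_trans[OF le] not_le_kappa_UNIV[OF d(1)] by blast
  qed
  \<comment> \<open>A label \<open>d\<close> as given by \<open>below_label\<close> cannot differ
    from \<open>j'\<close>, by \<open>du\<close>, and cannot be \<open>j'\<close>, as
    \<open>l\<close> is not below the partner of \<open>j'\<close>. Both \<open>j\<close> (by the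
    edge) and \<open>j'\<close> qualify as \<open>l\<close>.\<close>
  have sup_eq: "sup ?u l = x" if "l \<le> x" "\<not> l \<le> \<kappa> j'" for l
  proof (rule ccontr)
    assume "sup ?u l \<noteq> x"
    then have "sup ?u l < x" using that by (simp add: less_le)
    then obtain d where "d \<in> down_labels UNIV x" "sup ?u l \<le> \<kappa> d" by (rule below_label)
    with du that show False by (metis le_sup_iff)
  qed
  have "sup ?u j = sup ?u j'"
    using sup_eq[of j] sup_eq[of j'] j edge j'J not_le_kappa_UNIV by simp
  then show ?thesis
    using sup_inj[of j j' ?u] j(1) j'J by (simp add: le_infI2)
qed

text \<open>The order dual, with the edge reversed: no upper cover of \<open>x\<close> lies below
  the meet of \<open>?v\<close> with the partner of \<open>j\<close> or of \<open>j'\<close>, so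
  both meets are \<open>x\<close> and \<open>inf_inj\<close> applies.\<close>

lemma up_label_exchange:
  assumes j: "j \<in> JI" "x \<le> \<kappa> j" and j': "j' \<in> up_labels UNIV x"
    and edge: "\<not> j' \<le> \<kappa> j"
    and dk: "\<And>d. d \<in> up_labels UNIV x \<Longrightarrow> d \<noteq> j' \<Longrightarrow> j \<le> \<kappa> d \<and> j' \<le> \<kappa> d"
  shows "j = j'"
proof -
  let ?v = "sup x (sup j j')"
  have j'J: "j' \<in> JI" "x \<le> \<kappa> j'" using j' by (auto simp: up_labels_eq)
  have dv: "\<not> d \<le> ?v" if "d \<in> up_labels UNIV x" "d \<noteq> j'" for d
  proof -
    have d: "d \<in> JI" "x \<le> \<kappa> d" using that by (auto simp: up_labels_eq)
    with dk[OF that] have le: "?v \<le> \<kappa> d" by simp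
    show ?thesis
      using order_trans[OF _ le] not_le_kappa_UNIV[OF d(1)] by blast
  qed
  have inf_eq: "inf ?v (\<kappa> l) = x" if "x \<le> \<kappa> l" "\<not> j' \<le> \<kappa> l" for l
  proof (rule ccontr)
    assume "inf ?v (\<kappa> l) \<noteq> x"
    then have "x < inf ?v (\<kappa> l)" using that by (simp add: less_le)
    then obtain d where "d \<in> up_labels UNIV x" "d \<le> inf ?v (\<kappa> l)" by (rule above_label)
    with dv that show False by (metis le_inf_iff)
  qed
  have "inf ?v (\<kappa> j) = inf ?v (\<kappa> j')"
    using inf_eq[of j] inf_eq[of j'] j edge j'J not_le_kappa_UNIV by simp
  then show ?thesis
    using inf_inj[of j j' ?v] j(1) j'J by (simp add: le_supI2)
qed

end

section \<open>Orthogonality as inequalities, and tightness\<close>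

lemma orthogonal_pair_galois_graph:
  "orthogonal_pair (galois_graph S) X Y \<longleftrightarrow>
     X \<inter> Y = {} \<and> X \<subseteq> join_irreds S \<and> Y \<subseteq> join_irreds S \<and>
     (\<forall>i\<in>X. \<forall>j\<in>X. i \<noteq> j \<longrightarrow> i \<le> kappa S j) \<and>
     (\<forall>i\<in>Y. \<forall>j\<in>Y. i \<noteq> j \<longrightarrow> i \<le> kappa S j) \<and>
     (\<forall>i\<in>X. \<forall>j\<in>Y. i \<le> kappa S j)"
\<comment> \<open>Disjointness and containment in the vertex set discharge the side conditions
  hidden in an edge, leaving only inequalities; if either fails, both sides are false.\<close>
proof (cases "X \<inter> Y = {} \<and> X \<subseteq> join_irreds S \<and> Y \<subseteq> join_irreds S")
  case True
  have "(\<forall>i\<in>Z. \<forall>j\<in>Z. (i, j) \<notin> parcs (galois_graph S)) \<longleftrightarrow>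
      (\<forall>i\<in>Z. \<forall>j\<in>Z. i \<noteq> j \<longrightarrow> i \<le> kappa S j)" if "Z \<subseteq> join_irreds S" for Z
    by (intro ball_cong refl) (use that in \<open>auto simp: galois_graph_def\<close>)
  moreover have "(\<forall>i\<in>X. \<forall>j\<in>Y. (i, j) \<notin> parcs (galois_graph S)) \<longleftrightarrow>
      (\<forall>i\<in>X. \<forall>j\<in>Y. i \<le> kappa S j)"
    by (intro ball_cong refl) (use True in \<open>auto simp: galois_graph_def\<close>)
  moreover have "pverts (galois_graph S) = join_irreds S"
    by (simp add: galois_graph_def)
  ultimately show ?thesis
    using True by (simp add: orthogonal_pair_def independent_set_def)
next
  case False
  then show ?thesis
    by (auto simp: orthogonal_pair_def independent_set_def galois_graph_def)
qed

theorem theorem6p6: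
  fixes x :: "'a::{finite,lattice}"
  assumes "semidistrim (UNIV :: 'a set)"
  shows "tight_orthogonal_pair (galois_graph (UNIV :: 'a set))
           (down_labels UNIV x) (up_labels UNIV x)"
proof -
  let ?G = "galois_graph (UNIV :: 'a set)" and ?k = "kappa (UNIV :: 'a set)"
  let ?J = "join_irreds (UNIV :: 'a set)"
  let ?D = "down_labels UNIV x" and ?U = "up_labels UNIV x"
  have cd: "compatibly_dismantlable (UNIV :: 'a set)"
    and indep: "independent_set ?G ?D" "independent_set ?G ?U"
    using assms by (auto simp: semidistrim_def)
  note D = down_labels_eq[OF cd, of x] and U = up_labels_eq[OF cd, of x]
  note nle = not_le_kappa_UNIV[OF cd]
  have D_le: "d \<in> ?J" "d \<le> x" if "d \<in> ?D" for d
    using that by (auto simp: D)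
  have U_ge: "d \<in> ?J" "x \<le> ?k d" if "d \<in> ?U" for d
    using that by (auto simp: U)
  have orth: "orthogonal_pair ?G ?D ?U"
  proof -
    have le: "i \<le> ?k j" if "i \<in> ?D" "j \<in> ?U" for i j
      using D_le(2)[OF that(1)] U_ge(2)[OF that(2)] by (rule order_trans)
    then have "?D \<inter> ?U = {}" using nle D_le(1) by blast
    with indep le show ?thesis by (auto simp: orthogonal_pair_def galois_graph_def)
  qed
  \<comment> \<open>Absence of edges from \<open>j\<close> to the up labels puts \<open>j\<close>
    below all their partners, hence below \<open>x\<close>. The set \<open>X\<close> is arbitrary,
    so this serves both additions and exchanges.\<close>
  have le_x: "j \<le> x" if "orthogonal_pair ?G (X \<union> {j}) ?U" for j X
    using that ge_if_up_labels_ge[OF cd, of x j] by (simp add: orthogonal_pair_galois_graph)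
  have ge_x: "x \<le> ?k j" if "orthogonal_pair ?G ?D (Y \<union> {j})" for j Y
    using that le_if_down_labels_le[OF cd, of x "?k j"] by (simp add: orthogonal_pair_galois_graph)
  \<comment> \<open>Independence of the enlarged set puts every down label below
    \<open>kappa UNIV j\<close>, hence \<open>x\<close> as well; with \<open>j <= x\<close> this
    puts \<open>j\<close> below its own partner.\<close>
  have "\<not> orthogonal_pair ?G (?D \<union> {j}) ?U" if "j \<in> ?J" "j \<notin> ?D \<union> ?U" for j
  proof
    assume a: "orthogonal_pair ?G (?D \<union> {j}) ?U"
    have "x \<le> ?k j"
      by (rule le_if_down_labels_le[OF cd])
        (use a that in \<open>auto simp: orthogonal_pair_galois_graph\<close>)
    with le_x[OF a] nle[OF \<open>j \<in> ?J\<close>] show False by (meson order_trans)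
  qed
  moreover have "\<not> orthogonal_pair ?G ?D (?U \<union> {j})" if "j \<in> ?J" "j \<notin> ?D \<union> ?U" for j
  proof
    assume a: "orthogonal_pair ?G ?D (?U \<union> {j})"
    have "j \<le> x"
      by (rule ge_if_up_labels_ge[OF cd])
        (use a that in \<open>auto simp: orthogonal_pair_galois_graph\<close>)
    with ge_x[OF a] nle[OF \<open>j \<in> ?J\<close>] show False by (meson order_trans)
  qed
  moreover have "\<not> orthogonal_pair ?G ((?D - {j'}) \<union> {j}) ?U"
    if e: "(j, j') \<in> parcs ?G" "j \<notin> ?D \<union> ?U" "j' \<in> ?D" for j j'
  proof
    assume a: "orthogonal_pair ?G ((?D - {j'}) \<union> {j}) ?U"
    have e': "j \<in> ?J" "\<not> j \<le> ?k j'" using e by (auto simp: galois_graph_def)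
    \<comment> \<open>The first inequality is independence of the exchanged set, the second that of
      the original down labels.\<close>
    have "d \<le> ?k j" "d \<le> ?k j'" if "d \<in> ?D" "d \<noteq> j'" for d
      using a orth that e(2,3) by (auto simp: orthogonal_pair_galois_graph)
    then show False
      using down_label_exchange[OF cd e'(1) le_x[OF a] e(3) e'(2)] e by blast
  qed
  moreover have "\<not> orthogonal_pair ?G ?D ((?U - {j'}) \<union> {j})"
    if e: "(j', j) \<in> parcs ?G" "j \<notin> ?D \<union> ?U" "j' \<in> ?U" for j j'
  proof
    assume a: "orthogonal_pair ?G ?D ((?U - {j'}) \<union> {j})"
    have e': "j \<in> ?J" "\<not> j' \<le> ?k j" using e by (auto simp: galois_graph_def)
    have "j \<le> ?k d" "j' \<le> ?k d" if "d \<in> ?U" "d \<noteq> j'" for d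
      using a orth that e(2,3) by (auto simp: orthogonal_pair_galois_graph)
    then show False
      using up_label_exchange[OF cd e'(1) ge_x[OF a] e(3) e'(2)] e by blast
  qed
  moreover have "pverts ?G = ?J" by (simp add: galois_graph_def)
  ultimately show ?thesis
    using orth unfolding tight_orthogonal_pair_def by blast
qed

end
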